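(* Let $d,n_0,m,r\ge 1$ be integers and let $\Delta\subseteq\mathbb{E}^{d}$ be a simplex. Let $\mathcal{X}=\{\boldsymbol{v}_1,\dots,\boldsymbol{v}_m\}\subseteq \mathbb{P}_0\cong\mathbb{E}^{n_0}$ be any $m$-point set, and fix $\varepsilon>0$. Then there exist integers $n_1,\dots,n_m\ge 1$ with the following property: for every $r$-coloring $\chi$ of the orthogonal product $$\mathbb{P}:=\mathbb{P}_0\times\mathbb{P}_1\times\cdots\times\mathbb{P}_m,\qquad \mathbb{P}_i\cong\mathbb{E}^{n_i}\ (i=0,1,\dots,m),$$ that contains no monochromatic congruent copy of $\Delta$, there exist points $\boldsymbol{x}_i\in\mathbb{P}_i$ for $i=1,\dots,m$ such that, writing $\boldsymbol{p}_i:=(\boldsymbol{v}_i,\boldsymbol{x}_1,\dots,\boldsymbol{x}_m)\in\mathbb{P}$, for each $i\in\{1,\dots,m\}$ the $\varepsilon$-sphere $S_i(\boldsymbol{p}_i;\varepsilon)$ is not monochromatic under $\chi$.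
   Context: $\mathbb{E}^n$ denotes $n$-dimensional Euclidean space and $\|\cdot\|$ the Euclidean norm; the product $\mathbb{P}$ carries the Euclidean product metric (so $\mathbb{P}\cong\mathbb{E}^{n_0+\cdots+n_m}$). A simplex is identified with its vertex set, a finite affinely independent set of points. A congruent copy of a finite point set is its image under a distance-preserving map; a set is monochromatic if all its points have the same color. For a point $\boldsymbol{y}=(\boldsymbol{y}_0,\dots,\boldsymbol{y}_m)$ with $\boldsymbol{y}_i\in\mathbb{E}^{n_i}$ and an index $j\in\{1,\dots,m\}$, the $\varepsilon$-sphere of $\boldsymbol{y}$ in $\mathbb{E}^{n_j}$ is $$S_j(\boldsymbol{y};\varepsilon):=\{(\boldsymbol{y}_0,\dots,\boldsymbol{y}_{j-1},\boldsymbol{z},\boldsymbol{y}_{j+1},\dots,\boldsymbol{y}_m):\ \boldsymbol{z}\in\mathbb{E}^{n_j},\ \|\boldsymbol{z}-\boldsymbol{y}_j\|=\varepsilon\}.$$ *)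

theory Defs
  imports "HOL-Analysis.Analysis"
begin

text \<open>
  The dimensions \<open>n\<^sub>1, \<dots>, n\<^sub>m\<close> are existentially quantified in the theorem, so the factors cannot be
  modelled by types \<open>real ^ 'n\<close>. The carrier of \<open>E\<^sup>n\<close> is that of the library's \<^const>\<open>Euclidean_space\<close>:
  functions \<open>nat \<Rightarrow> real\<close> vanishing outside \<open>{..<n}\<close>, so that each point has exactly one representation.
\<close>

abbreviation Eucl :: "nat \<Rightarrow> (nat \<Rightarrow> real) set" where
  "Eucl n \<equiv> topspace (Euclidean_space n)"

definition Eucl_dist :: "nat \<Rightarrow> (nat \<Rightarrow> real) \<Rightarrow> (nat \<Rightarrow> real) \<Rightarrow> real" where
  "Eucl_dist n x y = L2_set (\<lambda>k. x k - y k) {..<n}"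

text \<open>
  A point of the product is a family indexed by \<open>{0..m}\<close>, \<^const>\<open>undefined\<close> at all other indices.
\<close>

definition Prod_space :: "nat \<Rightarrow> (nat \<Rightarrow> nat) \<Rightarrow> (nat \<Rightarrow> nat \<Rightarrow> real) set" where
  "Prod_space m n = (\<Pi>\<^sub>E i\<in>{0..m}. Eucl (n i))"

definition Prod_dist ::
    "nat \<Rightarrow> (nat \<Rightarrow> nat) \<Rightarrow> (nat \<Rightarrow> nat \<Rightarrow> real) \<Rightarrow> (nat \<Rightarrow> nat \<Rightarrow> real) \<Rightarrow> real" where
  "Prod_dist m n x y = L2_set (\<lambda>i. Eucl_dist (n i) (x i) (y i)) {0..m}"

definition simplex_vertices :: "'a::real_vector set \<Rightarrow> bool" where
  "simplex_vertices \<Delta> \<longleftrightarrow> finite \<Delta> \<and> \<not> affine_dependent \<Delta>"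

definition congruent_copy_in ::
    "nat \<Rightarrow> (nat \<Rightarrow> nat) \<Rightarrow> 'a::metric_space set \<Rightarrow> (nat \<Rightarrow> nat \<Rightarrow> real) set \<Rightarrow> bool" where
  "congruent_copy_in m n \<Delta> T \<longleftrightarrow>
     (\<exists>f\<in>\<Delta> \<rightarrow> Prod_space m n.
        (\<forall>x\<in>\<Delta>. \<forall>y\<in>\<Delta>. Prod_dist m n (f x) (f y) = dist x y) \<and> T = f ` \<Delta>)"

definition monochromatic :: "('p \<Rightarrow> nat) \<Rightarrow> 'p set \<Rightarrow> bool" where
  "monochromatic col T \<longleftrightarrow> col constant_on T"

definition eps_sphere ::
    "(nat \<Rightarrow> nat) \<Rightarrow> nat \<Rightarrow> (nat \<Rightarrow> nat \<Rightarrow> real) \<Rightarrow> real \<Rightarrow> (nat \<Rightarrow> nat \<Rightarrow> real) set" where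
  "eps_sphere n j y \<epsilon> = {y(j := z) | z. z \<in> Eucl (n j) \<and> Eucl_dist (n j) z (y j) = \<epsilon>}"

end

theory Submission
  imports "HOL-Library.Ramsey" Defs
begin

text \<open>
  Simplices are Ramsey (Frankl and Roedl): if \<open>N\<close> is large enough in terms of \<open>\<Delta>\<close> and \<open>r\<close>, then every
  \<open>r\<close>-coloring of \<open>E\<^sup>N\<close> contains a monochromatic congruent copy of \<open>\<Delta>\<close>. Choose all of
  \<open>n\<^sub>1, \<dots>, n\<^sub>m\<close> larger than such an \<open>N\<close>. The product contains isometric copies of its
  factors, so already the first factor \<open>P\<^sub>1\<close>, placed in the product with all other components zero,
  meets every coloring in a monochromatic copy of \<open>\<Delta>\<close>. Hence no \<open>r\<close>-coloring of this product avoids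
  such copies, and the required property of \<open>n\<^sub>1, \<dots>, n\<^sub>m\<close> holds. All of the work is in the
  Ramsey property of simplices.

  For this, fix a list \<open>a\<close> of \<open>k\<close> nonzero reals. A \<open>k\<close>-subset \<open>S\<close> of \<open>{..<N}\<close> gives a spread vector: the
  entries of \<open>a\<close>, in their order, in the coordinates \<open>S\<close>, and zero elsewhere. A coloring of \<open>E\<^sup>N\<close> thus
  colors the \<open>k\<close>-subsets, and Ramsey's theorem yields a large set \<open>H\<close> of coordinates such that all
  spread vectors supported in \<open>H\<close> have the same color. So a finite set is Ramsey as soon as it is
  congruent to a set of spread vectors with a common \<open>a\<close> (\<open>spread_metric_Ramsey\<close>). It remains to find a
  simplex among spread vectors, following an idea of Matousek and Roedl.

  Fix the vertex set \<open>V\<close>. The squared distances on \<open>V\<close> that spread vectors realize form a convex cone,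
  because vectors can be concatenated. The squared distance of points on a line is a limit of elements
  of the cone: take \<open>a\<close> to be the long tent \<open>1, 2, \<dots>, L, \<dots>, 2, 1\<close> and shift it along the coordinates by
  integers \<open>T x\<close>; two shifts differ by \<open>T x - T y\<close> in nearly all coordinates, up to sign
  (\<open>spread_limit_line_nat\<close>). By summing over coordinates, all squared Euclidean distances are limits of
  elements of the cone (\<open>spread_limit_dist\<close>).

  The squared distance of an affinely independent set lies in the interior of the set of all squared
  Euclidean distances, and a convex set contains the interior of its closure, so it lies in the cone
  itself. Concretely, affine independence makes it possible to subtract a small multiple of the metric of a
  regular simplex and keep a limit (\<open>lower_vertices\<close>), and adding this multiple back leads from limits to
  the cone (\<open>spread_metric_interior\<close>).
\<close>

section \<open>Spread vectors\<close>

definition place :: "nat list \<Rightarrow> real list \<Rightarrow> nat \<Rightarrow> real" where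
  "place hs u c = (case map_of (zip hs u) c of None \<Rightarrow> 0 | Some t \<Rightarrow> t)"

lemma place_Nil [simp]: "place [] u = (\<lambda>_. 0)"
  by (simp add: place_def fun_eq_iff)

lemma place_Cons [simp]: "place (h # hs) (t # u) = (place hs u)(h := t)"
  by (simp add: place_def fun_eq_iff)

lemma place_outside: "c \<notin> set hs \<Longrightarrow> place hs u c = 0"
  by (auto simp: place_def split: option.splits dest: map_of_SomeD set_zip_leftD)

lemma place_in_Eucl: "set hs \<subseteq> {..<M} \<Longrightarrow> place hs u \<in> Eucl M"
  by (fastforce simp: topspace_Euclidean_space intro: place_outside)

text \<open>
  Zero entries do not affect the vector. Therefore vectors placed on the same coordinates, but with
  their zeros in different positions, become spread vectors of the same list of nonzero entries.
\<close>

lemma place_filter_nonzero: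
  assumes "length hs = length u" and "sorted_wrt (<) hs"
  shows "\<exists>hs'. sorted_wrt (<) hs' \<and> set hs' \<subseteq> set hs \<and>
           length hs' = length (filter (\<lambda>t. t \<noteq> 0) u) \<and>
           place hs' (filter (\<lambda>t. t \<noteq> 0) u) = place hs u"
  using assms
proof (induction hs u rule: list_induct2)
  case Nil
  then show ?case by simp
next
  case (Cons h hs t u)
  then obtain hs' where hs': "sorted_wrt (<) hs'" "set hs' \<subseteq> set hs"
      "length hs' = length (filter (\<lambda>t. t \<noteq> 0) u)"
      "place hs' (filter (\<lambda>t. t \<noteq> 0) u) = place hs u"
    by auto
  show ?case
  proof (cases "t = 0")
    case True
    have "h \<notin> set hs"
      using Cons.prems by auto
    then have "place (h # hs) (t # u) = place hs u"
      using True by (auto simp: fun_eq_iff place_outside)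
    with True hs' show ?thesis by (intro exI[of _ hs']) auto
  next
    case False
    with hs' Cons.prems show ?thesis by (intro exI[of _ "h # hs'"]) auto
  qed
qed

definition sq_dist_list :: "real list \<Rightarrow> real list \<Rightarrow> real" where
  "sq_dist_list u w = (\<Sum>(s, t)\<leftarrow>zip u w. (s - t)\<^sup>2)"

lemma sum_sq_diff_place:
  assumes "length hs = length u" and "length u = length w"
    and "distinct hs" and "finite A" and "set hs \<subseteq> A"
  shows "(\<Sum>c\<in>A. (place hs u c - place hs w c)\<^sup>2) = sq_dist_list u w"
  using assms
proof (induction hs u w rule: list_induct3)
  case Nil
  then show ?case by (simp add: sq_dist_list_def)
next
  case (Cons h hs t u s w)
  have "(\<Sum>c\<in>A. (place hs u c - place hs w c)\<^sup>2)
      = (\<Sum>c\<in>A - {h}. (place hs u c - place hs w c)\<^sup>2)"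
    using Cons.prems by (intro sum.mono_neutral_right) (auto simp: place_outside)
  also have "\<dots> = (\<Sum>c\<in>A - {h}. (place (h # hs) (t # u) c - place (h # hs) (s # w) c)\<^sup>2)"
    by (intro sum.cong) auto
  finally show ?case
    using Cons by (simp add: sq_dist_list_def sum.remove[of A h])
qed

lemma sq_dist_list_map:
  "sq_dist_list (map f [0..<K]) (map g [0..<K]) = (\<Sum>i<K. (f i - g i)\<^sup>2)"
  by (induction K) (simp_all add: sq_dist_list_def)

lemma sq_dist_list_append:
  "length u = length w \<Longrightarrow>
    sq_dist_list (u @ u') (w @ w') = sq_dist_list u w + sq_dist_list u' w'"
  by (simp add: sq_dist_list_def)

lemma sq_dist_list_scale:
  "sq_dist_list (map ((*) c) u) (map ((*) c) w) = c\<^sup>2 * sq_dist_list u w"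
  by (induction u w rule: list_induct2')
     (simp_all add: sq_dist_list_def algebra_simps power2_eq_square)

lemma sq_dist_list_commute: "sq_dist_list u w = sq_dist_list w u"
  by (induction u w rule: list_induct2') (simp_all add: sq_dist_list_def power2_commute)

lemma sq_dist_list_self: "sq_dist_list u u = 0"
  by (induction u) (simp_all add: sq_dist_list_def)

text \<open>
  \<open>D\<close> is the squared distance of a family of spread vectors with common list \<open>a\<close> of nonzero entries. Each
  vector is a list of fixed length that contains \<open>a\<close> interspersed with zeros, so that the order of the
  nonzero entries is implicit and direct sums are appended lists.
\<close>

definition spread_metric :: "'a set \<Rightarrow> ('a \<Rightarrow> 'a \<Rightarrow> real) \<Rightarrow> bool" where
  "spread_metric V D \<longleftrightarrow>
     (\<exists>L a u. (\<forall>x\<in>V. length (u x) = L \<and> filter (\<lambda>t. t \<noteq> 0) (u x) = a) \<and>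
              (\<forall>x\<in>V. \<forall>y\<in>V. sq_dist_list (u x) (u y) = D x y))"

text \<open>
  A \<open>length a\<close>-subset \<open>S\<close> of the coordinates gets the color of the spread vector of \<open>a\<close> on \<open>S\<close>. Place the
  lists \<open>u x\<close> on a homogeneous set of size \<open>L\<close>: every vector obtained is the spread vector on one of its
  subsets.
\<close>

lemma spread_metric_Ramsey:
  fixes r :: nat
  assumes "spread_metric V D"
  obtains N where "\<And>M col. N \<le> M \<Longrightarrow> col \<in> Eucl M \<rightarrow> {1..r} \<Longrightarrow>
    \<exists>f\<in>V \<rightarrow> Eucl M. (\<forall>x\<in>V. \<forall>y\<in>V. Eucl_dist M (f x) (f y) = sqrt (D x y)) \<and>
      col constant_on (f ` V)"
proof -
  from assms obtain L a u
    where len: "\<And>x. x \<in> V \<Longrightarrow> length (u x) = L"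
      and filt: "\<And>x. x \<in> V \<Longrightarrow> filter (\<lambda>t. t \<noteq> 0) (u x) = a"
      and dist: "\<And>x y. x \<in> V \<Longrightarrow> y \<in> V \<Longrightarrow> sq_dist_list (u x) (u y) = D x y"
    unfolding spread_metric_def by blast
  obtain N :: nat where N: "partn_lst {..<N} (replicate r L) (length a)"
    using ramsey_full by blast
  show ?thesis
  proof
    fix M and col :: "(nat \<Rightarrow> real) \<Rightarrow> nat"
    assume M: "N \<le> M" and col: "col \<in> Eucl M \<rightarrow> {1..r}"
    define g where "g S = col (place (sorted_list_of_set S) a) - 1" for S
    have g_col: "col (place (sorted_list_of_set S) a) = g S + 1 \<and> g S < r"
      if "S \<in> nsets {..<N} (length a)" for S
    proof -
      have "place (sorted_list_of_set S) a \<in> Eucl M"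
        using that M by (intro place_in_Eucl) (auto simp: nsets_def)
      with col have "col (place (sorted_list_of_set S) a) \<in> {1..r}" by blast
      then show ?thesis by (auto simp: g_def)
    qed
    then have "g \<in> nsets {..<N} (length a) \<rightarrow> {..<r}" by auto
    with N obtain i H where i: "i < r" and H: "H \<in> nsets {..<N} L"
        and mono: "g ` nsets H (length a) \<subseteq> {i}"
      by (elim partn_lstE) auto
    define hs where "hs = sorted_list_of_set H"
    have hs: "sorted_wrt (<) hs" "distinct hs" "set hs = H" "length hs = L"
      using H by (auto simp: hs_def nsets_def)
    have HN: "H \<subseteq> {..<N}" "finite H" using H by (auto simp: nsets_def)
    define f where "f x = place hs (u x)" for x
    have "f \<in> V \<rightarrow> Eucl M"
      unfolding f_def using hs(3) HN M by (intro Pi_I place_in_Eucl) auto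
    moreover have "Eucl_dist M (f x) (f y) = sqrt (D x y)" if "x \<in> V" "y \<in> V" for x y
    proof -
      have "(\<Sum>c<M. (f x c - f y c)\<^sup>2) = sq_dist_list (u x) (u y)"
        unfolding f_def using that hs HN M
        by (intro sum_sq_diff_place) (auto simp: len)
      then show ?thesis
        using that by (simp add: Eucl_dist_def L2_set_def dist)
    qed
    moreover have "col (f x) = i + 1" if "x \<in> V" for x
    proof -
      have "length hs = length (u x)" using that hs len by simp
      from place_filter_nonzero[OF this hs(1)] filt[OF that]
      obtain hs' where hs': "sorted_wrt (<) hs'" "set hs' \<subseteq> H" "length hs' = length a"
          "place hs' a = f x"
        by (auto simp: f_def hs(3))
      have eq: "sorted_list_of_set (set hs') = hs'"
        using hs'(1) by (simp add: sorted_list_of_set.idem_if_sorted_distinct strict_sorted_iff)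
      have "set hs' \<in> nsets H (length a)"
        using hs' by (auto simp: nsets_def distinct_card strict_sorted_iff)
      moreover from this have "set hs' \<in> nsets {..<N} (length a)"
        using HN nsets_mono by blast
      ultimately show ?thesis
        using g_col[of "set hs'"] mono hs'(4) eq by auto
    qed
    then have "col constant_on (f ` V)"
      by (auto simp: constant_on_def)
    ultimately show "\<exists>f\<in>V \<rightarrow> Eucl M.
        (\<forall>x\<in>V. \<forall>y\<in>V. Eucl_dist M (f x) (f y) = sqrt (D x y)) \<and> col constant_on (f ` V)"
      by blast
  qed
qed

section \<open>The cone of spread metrics\<close>

lemma spread_metric_cong:
  "spread_metric V D \<Longrightarrow> (\<And>x y. x \<in> V \<Longrightarrow> y \<in> V \<Longrightarrow> D x y = D' x y) \<Longrightarrow> spread_metric V D'"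
  unfolding spread_metric_def by (metis (no_types, lifting))

lemma spread_metric_commute:
  "spread_metric V D \<Longrightarrow> x \<in> V \<Longrightarrow> y \<in> V \<Longrightarrow> D x y = D y x"
  unfolding spread_metric_def by (metis sq_dist_list_commute)

lemma spread_metric_self: "spread_metric V D \<Longrightarrow> x \<in> V \<Longrightarrow> D x x = 0"
  unfolding spread_metric_def by (metis sq_dist_list_self)

lemma spread_metric_functions:
  assumes "\<And>x. x \<in> V \<Longrightarrow> filter (\<lambda>t. t \<noteq> 0) (map (f x) [0..<K]) = a"
  shows "spread_metric V (\<lambda>x y. \<Sum>i<K. (f x i - f y i)\<^sup>2)"
  unfolding spread_metric_def using assms
  by (intro exI[of _ K] exI[of _ a] exI[of _ "\<lambda>x. map (f x) [0..<K]"])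
     (simp add: sq_dist_list_map)

lemma spread_metric_zero: "spread_metric V (\<lambda>_ _. 0)"
  using spread_metric_functions[of V "\<lambda>_ _. 0" 0 "[]"] by simp

lemma spread_metric_add:
  assumes "spread_metric V D" and "spread_metric V E"
  shows "spread_metric V (\<lambda>x y. D x y + E x y)"
proof -
  from assms obtain L a u L' a' u'
    where "\<forall>x\<in>V. length (u x) = L \<and> filter (\<lambda>t. t \<noteq> 0) (u x) = a"
      and "\<forall>x\<in>V. \<forall>y\<in>V. sq_dist_list (u x) (u y) = D x y"
      and "\<forall>x\<in>V. length (u' x) = L' \<and> filter (\<lambda>t. t \<noteq> 0) (u' x) = a'"
      and "\<forall>x\<in>V. \<forall>y\<in>V. sq_dist_list (u' x) (u' y) = E x y"
    unfolding spread_metric_def by blast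
  then show ?thesis
    unfolding spread_metric_def
    by (intro exI[of _ "L + L'"] exI[of _ "a @ a'"] exI[of _ "\<lambda>x. u x @ u' x"])
       (simp add: sq_dist_list_append)
qed

lemma spread_metric_scale:
  assumes "spread_metric V D" and "c \<ge> 0"
  shows "spread_metric V (\<lambda>x y. c * D x y)"
proof (cases "c = 0")
  case True
  then show ?thesis by (simp add: spread_metric_zero)
next
  case False
  from assms obtain L a u
    where u: "\<forall>x\<in>V. length (u x) = L \<and> filter (\<lambda>t. t \<noteq> 0) (u x) = a"
        "\<forall>x\<in>V. \<forall>y\<in>V. sq_dist_list (u x) (u y) = D x y"
    unfolding spread_metric_def by blast
  have "filter (\<lambda>t. t \<noteq> 0) (map ((*) (sqrt c)) (u x)) = map ((*) (sqrt c)) a" if "x \<in> V" for x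
    using u(1) that False by (auto simp: filter_map o_def)
  with u \<open>c \<ge> 0\<close> show ?thesis
    unfolding spread_metric_def
    by (intro exI[of _ L] exI[of _ "map ((*) (sqrt c)) a"] exI[of _ "\<lambda>x. map ((*) (sqrt c)) (u x)"])
       (simp add: sq_dist_list_scale)
qed

lemma spread_metric_sum:
  assumes "finite I" and "\<And>i. i \<in> I \<Longrightarrow> spread_metric V (D i)"
  shows "spread_metric V (\<lambda>x y. \<Sum>i\<in>I. D i x y)"
  using assms by (induction I) (simp_all add: spread_metric_zero spread_metric_add)

text \<open>
  One nonzero entry, placed at position \<open>g x\<close>: two vectors agree or are orthogonal.
\<close>

lemma spread_metric_partition:
  fixes g :: "'a \<Rightarrow> nat"
  assumes "finite V"
  shows "spread_metric V (\<lambda>x y. if g x = g y then 0 else 1)"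
proof -
  obtain K where K: "\<And>x. x \<in> V \<Longrightarrow> g x < K"
    using finite_nat_set_iff_bounded[of "g ` V"] assms by auto
  define f where "f x i = (if i = g x then sqrt (1/2) else 0)" for x i
  have "filter (\<lambda>t. t \<noteq> 0) (map (f x) [0..<K]) = [sqrt (1/2)]" if "x \<in> V" for x
  proof -
    have "[0..<K] = [0..<g x] @ g x # [Suc (g x)..<K]"
    proof -
      obtain k where "K = g x + Suc k"
        using less_imp_Suc_add[OF K[OF \<open>x \<in> V\<close>]] by auto
      then show ?thesis
        by (simp only: upt_add_eq_append[OF le0]) (simp add: upt_conv_Cons)
    qed
    then show ?thesis by (simp add: f_def filter_map o_def filter_empty_conv)
  qed
  then have "spread_metric V (\<lambda>x y. \<Sum>i<K. (f x i - f y i)\<^sup>2)"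
    by (rule spread_metric_functions)
  moreover have "(\<Sum>i<K. (f x i - f y i)\<^sup>2) = (if g x = g y then 0 else 1)"
    if "x \<in> V" "y \<in> V" for x y
  proof (cases "g x = g y")
    case True
    then show ?thesis by (simp add: f_def)
  next
    case False
    have "(\<Sum>i<K. (f x i - f y i)\<^sup>2)
        = (\<Sum>i<K. (if i = g x then 1/2 else 0) + (if i = g y then 1/2 else 0))"
      using False by (intro sum.cong) (auto simp: f_def)
    also have "\<dots> = 1"
      using K that by (simp add: sum.distrib)
    finally show ?thesis using False by simp
  qed
  ultimately show ?thesis by (rule spread_metric_cong)
qed

section \<open>Limits of spread metrics\<close>

definition spread_limit :: "'a set \<Rightarrow> ('a \<Rightarrow> 'a \<Rightarrow> real) \<Rightarrow> bool" where
  "spread_limit V D \<longleftrightarrow>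
     (\<forall>\<mu>>0. \<exists>D'. spread_metric V D' \<and> (\<forall>x\<in>V. \<forall>y\<in>V. \<bar>D' x y - D x y\<bar> \<le> \<mu>))"

lemma spread_limit_limit:
  assumes "\<And>\<mu>. \<mu> > 0 \<Longrightarrow>
    \<exists>D'. spread_limit V D' \<and> (\<forall>x\<in>V. \<forall>y\<in>V. \<bar>D' x y - D x y\<bar> \<le> \<mu>)"
  shows "spread_limit V D"
  unfolding spread_limit_def
proof (intro allI impI)
  fix \<mu> :: real
  assume "\<mu> > 0"
  with assms[of "\<mu>/2"] obtain D' where D': "spread_limit V D'"
      "\<And>x y. x \<in> V \<Longrightarrow> y \<in> V \<Longrightarrow> \<bar>D' x y - D x y\<bar> \<le> \<mu>/2"
    by auto
  with \<open>\<mu> > 0\<close> obtain D'' where D'': "spread_metric V D''"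
      "\<And>x y. x \<in> V \<Longrightarrow> y \<in> V \<Longrightarrow> \<bar>D'' x y - D' x y\<bar> \<le> \<mu>/2"
    unfolding spread_limit_def by (meson half_gt_zero)
  have "\<bar>D'' x y - D x y\<bar> \<le> \<mu>" if "x \<in> V" "y \<in> V" for x y
    using D'(2)[OF that] D''(2)[OF that] by linarith
  with D'' show "\<exists>D'. spread_metric V D' \<and> (\<forall>x\<in>V. \<forall>y\<in>V. \<bar>D' x y - D x y\<bar> \<le> \<mu>)"
    by blast
qed

lemma spread_metric_imp_limit: "spread_metric V D \<Longrightarrow> spread_limit V D"
  unfolding spread_limit_def by (intro allI impI exI[of _ D]) auto

lemma spread_limit_cong:
  "spread_limit V D \<Longrightarrow> (\<And>x y. x \<in> V \<Longrightarrow> y \<in> V \<Longrightarrow> D x y = D' x y) \<Longrightarrow> spread_limit V D'"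
  unfolding spread_limit_def by simp

lemma spread_limit_add:
  assumes "spread_limit V D" and "spread_limit V E"
  shows "spread_limit V (\<lambda>x y. D x y + E x y)"
  unfolding spread_limit_def
proof (intro allI impI)
  fix \<mu> :: real
  assume "\<mu> > 0"
  then have "\<mu>/2 > 0" by simp
  with assms obtain D' E' where D': "spread_metric V D'"
      "\<And>x y. x \<in> V \<Longrightarrow> y \<in> V \<Longrightarrow> \<bar>D' x y - D x y\<bar> \<le> \<mu>/2"
    and E': "spread_metric V E'"
      "\<And>x y. x \<in> V \<Longrightarrow> y \<in> V \<Longrightarrow> \<bar>E' x y - E x y\<bar> \<le> \<mu>/2"
    unfolding spread_limit_def by meson
  have "\<bar>D' x y + E' x y - (D x y + E x y)\<bar> \<le> \<mu>" if "x \<in> V" "y \<in> V" for x y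
    using D'(2)[OF that] E'(2)[OF that] by linarith
  with spread_metric_add[OF D'(1) E'(1)]
  show "\<exists>D'. spread_metric V D' \<and> (\<forall>x\<in>V. \<forall>y\<in>V. \<bar>D' x y - (D x y + E x y)\<bar> \<le> \<mu>)"
    by (intro exI[of _ "\<lambda>x y. D' x y + E' x y"]) simp
qed

lemma spread_limit_scale:
  assumes "spread_limit V D" and "c \<ge> 0"
  shows "spread_limit V (\<lambda>x y. c * D x y)"
  unfolding spread_limit_def
proof (intro allI impI)
  fix \<mu> :: real
  assume "\<mu> > 0"
  then have "\<mu> / (c + 1) > 0" using \<open>c \<ge> 0\<close> by simp
  with assms obtain D' where D': "spread_metric V D'"
      "\<And>x y. x \<in> V \<Longrightarrow> y \<in> V \<Longrightarrow> \<bar>D' x y - D x y\<bar> \<le> \<mu> / (c + 1)"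
    unfolding spread_limit_def by meson
  have "\<bar>c * D' x y - c * D x y\<bar> \<le> \<mu>" if "x \<in> V" "y \<in> V" for x y
  proof -
    have "\<bar>c * D' x y - c * D x y\<bar> = c * \<bar>D' x y - D x y\<bar>"
      using \<open>c \<ge> 0\<close> by (simp add: abs_mult flip: right_diff_distrib)
    also have "\<dots> \<le> c * (\<mu> / (c + 1))"
      using D'(2)[OF that] \<open>c \<ge> 0\<close> by (rule mult_left_mono)
    also have "\<dots> \<le> \<mu>"
      using \<open>c \<ge> 0\<close> \<open>\<mu> > 0\<close> by (simp add: field_simps)
    finally show ?thesis .
  qed
  with spread_metric_scale[OF D'(1) \<open>c \<ge> 0\<close>]
  show "\<exists>D'. spread_metric V D' \<and> (\<forall>x\<in>V. \<forall>y\<in>V. \<bar>D' x y - c * D x y\<bar> \<le> \<mu>)"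
    by (intro exI[of _ "\<lambda>x y. c * D' x y"]) simp
qed

lemma spread_limit_sum:
  assumes "finite I" and "\<And>i. i \<in> I \<Longrightarrow> spread_limit V (D i)"
  shows "spread_limit V (\<lambda>x y. \<Sum>i\<in>I. D i x y)"
  using assms
  by (induction I) (simp_all add: spread_metric_imp_limit spread_metric_zero spread_limit_add)

text \<open>
  The profile \<open>h\<close> is a tent of slope one and height \<open>L\<close>, translated by \<open>T x\<close>. Two translates differ by at
  most \<open>\<bar>T x - T y\<bar>\<close> everywhere and by exactly this amount wherever both rise or both fall,
  which is the case at all but at most \<open>3 * B\<close> of the \<open>K\<close> positions. Dividing by \<open>K\<close>, the error tends to zero as \<open>L\<close> grows. A ramp
  without the falling side would not do: its end would contribute about \<open>L\<^sup>2\<close> per unit of the shift.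
\<close>

lemma spread_limit_line_nat:
  fixes T :: "'a \<Rightarrow> nat"
  assumes "finite V"
  shows "spread_limit V (\<lambda>x y. (real (T x) - real (T y))\<^sup>2)"
  unfolding spread_limit_def
proof (intro allI impI)
  fix \<mu> :: real
  assume "\<mu> > 0"
  obtain B where B: "\<And>x. x \<in> V \<Longrightarrow> T x \<le> B"
    using assms finite_nat_set_iff_bounded_le[of "T ` V"] by auto
  obtain L0 :: nat where L0: "3 * real B ^ 3 / \<mu> < real L0"
    using reals_Archimedean2 by blast
  define L where "L = L0 + B + 1"
  have L: "L > B" "L > 0" "3 * real B ^ 3 \<le> \<mu> * real L"
  proof -
    have "3 * real B ^ 3 / \<mu> \<le> real L" using L0 by (simp add: L_def)
    then show "3 * real B ^ 3 \<le> \<mu> * real L"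
      using \<open>\<mu> > 0\<close> by (simp add: field_simps)
  qed (auto simp: L_def)
  define K where "K = 2 * L + B"
  define h :: "real \<Rightarrow> real" where "h s = max 0 (real L - \<bar>s - real L\<bar>)" for s
  define f where "f x i = h (real i - real (T x))" for x i
  define E where "E x y = (\<Sum>i<K. (f x i - f y i)\<^sup>2)" for x y
  have "filter (\<lambda>t. t \<noteq> 0) (map (f x) [0..<K])
      = filter (\<lambda>t. t \<noteq> 0) (map (\<lambda>j. h (real j)) [0..<2 * L])" if "x \<in> V" for x
  proof -
    have "K = T x + 2 * L + (B - T x)"
      using B[OF that] by (simp add: K_def)
    then have K: "[0..<K] = [0..<T x] @ [T x..<T x + 2 * L] @ [T x + 2 * L..<K]"
      by (metis append.assoc le0 upt_add_eq_append)
    have "map (f x) [T x..<T x + 2 * L] = map (\<lambda>j. h (real j)) [0..<2 * L]"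
      by (simp add: f_def list_eq_iff_nth_eq)
    moreover have "filter (\<lambda>t. t \<noteq> 0) (map (f x) [0..<T x]) = []"
      and "filter (\<lambda>t. t \<noteq> 0) (map (f x) [T x + 2 * L..<K]) = []"
      by (auto simp: filter_empty_conv f_def h_def)
    ultimately show ?thesis unfolding K by simp
  qed
  then have "spread_metric V E"
    unfolding E_def by (rule spread_metric_functions)
  then have "spread_metric V (\<lambda>x y. (1 / real K) * E x y)"
    by (rule spread_metric_scale) simp
  moreover have "\<bar>(1 / real K) * E x y - (real (T x) - real (T y))\<^sup>2\<bar> \<le> \<mu>"
    if "x \<in> V" "y \<in> V" for x y
  proof -
    define s where "s = real (T x) - real (T y)"
    have s: "s\<^sup>2 \<le> (real B)\<^sup>2"
      using B[OF that(1)] B[OF that(2)] unfolding s_def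
      by (intro power2_le_iff_abs_le[THEN iffD2]) auto
    have "(f x i - f y i)\<^sup>2 \<le> s\<^sup>2" for i
    proof -
      have "\<bar>f x i - f y i\<bar> \<le> \<bar>s\<bar>"
        unfolding f_def h_def s_def by linarith
      then show ?thesis by (simp add: abs_le_square_iff)
    qed
    then have "E x y \<le> (\<Sum>i<K. s\<^sup>2)"
      unfolding E_def by (rule sum_mono)
    then have upper: "E x y \<le> K * s\<^sup>2" by simp
    \<comment> \<open>the positions where both translates rise or both fall\<close>
    define G where "G = {B..<L} \<union> {L + B..<2 * L}"
    have G: "G \<subseteq> {..<K}" "card G = 2 * (L - B)"
      using L by (auto simp: G_def K_def card_Un_disjoint)
    have "(f x i - f y i)\<^sup>2 = s\<^sup>2" if "i \<in> G" for i
    proof -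
      have "f x i - f y i = - s \<or> f x i - f y i = s"
        using that B[OF \<open>x \<in> V\<close>] B[OF \<open>y \<in> V\<close>]
        by (auto simp: G_def f_def h_def s_def)
      then show ?thesis by auto
    qed
    then have "(\<Sum>i\<in>G. s\<^sup>2) = (\<Sum>i\<in>G. (f x i - f y i)\<^sup>2)" by simp
    also have "\<dots> \<le> E x y"
      unfolding E_def using G by (intro sum_mono2) auto
    finally have lower: "2 * (real L - real B) * s\<^sup>2 \<le> E x y"
      using G L by (simp add: of_nat_diff)
    have "real K * s\<^sup>2 - E x y \<le> 3 * real B * s\<^sup>2"
      using lower by (simp add: K_def algebra_simps)
    also have "\<dots> \<le> 3 * real B ^ 3"
      using mult_left_mono[OF s, of "3 * real B"] by (simp add: power3_eq_cube power2_eq_square)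
    also have "\<dots> \<le> \<mu> * real L" by (rule L)
    also have "\<dots> \<le> \<mu> * real K"
      using \<open>\<mu> > 0\<close> by (simp add: K_def)
    finally have "\<bar>E x y - K * s\<^sup>2\<bar> \<le> \<mu> * real K"
      using upper by simp
    moreover have "(1 / real K) * E x y - s\<^sup>2 = (E x y - K * s\<^sup>2) / K"
      using L by (simp add: K_def field_simps)
    ultimately show ?thesis
      using L by (simp add: K_def field_simps s_def)
  qed
  ultimately show "\<exists>D'. spread_metric V D' \<and>
      (\<forall>x\<in>V. \<forall>y\<in>V. \<bar>D' x y - (real (T x) - real (T y))\<^sup>2\<bar> \<le> \<mu>)"
    by (intro exI[of _ "\<lambda>x y. (1 / real K) * E x y"]) blast
qed

text \<open>
  Real positions are rounded to integers on a scale that is fine compared with their size.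
\<close>

lemma spread_limit_line:
  fixes t :: "'a \<Rightarrow> real"
  assumes "finite V"
  shows "spread_limit V (\<lambda>x y. (t x - t y)\<^sup>2)"
proof (rule spread_limit_limit)
  fix \<mu> :: real
  assume "\<mu> > 0"
  obtain C where C: "C > 0" "\<And>x. x \<in> V \<Longrightarrow> \<bar>t x\<bar> \<le> C"
    using finite_imp_bounded[of "t ` V"] assms by (auto simp: bounded_pos)
  obtain M0 :: nat where M0: "(4 * C + 1) / \<mu> < real M0"
    using reals_Archimedean2 by blast
  define M where "M = real M0 + 1"
  have M: "M \<ge> 1" "4 * C + 1 \<le> \<mu> * M"
    using M0 \<open>\<mu> > 0\<close> by (auto simp: M_def field_simps)
  define T where "T x = nat \<lfloor>M * (t x + C)\<rfloor>" for x
  have "spread_limit V (\<lambda>x y. (1 / M\<^sup>2) * (real (T x) - real (T y))\<^sup>2)"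
    using spread_limit_line_nat[OF assms] by (rule spread_limit_scale) simp
  moreover have "\<bar>(1 / M\<^sup>2) * (real (T x) - real (T y))\<^sup>2 - (t x - t y)\<^sup>2\<bar> \<le> \<mu>"
    if "x \<in> V" "y \<in> V" for x y
  proof -
    have T: "real (T z) = of_int \<lfloor>M * (t z + C)\<rfloor>" if "z \<in> V" for z
      using C(2)[OF that] M by (simp add: T_def)
    define a where "a = (real (T x) - real (T y)) / M"
    define b where "b = t x - t y"
    have "\<bar>(real (T x) - real (T y)) - M * b\<bar> \<le> 1"
      using T[OF that(1)] T[OF that(2)] by (simp add: b_def algebra_simps) linarith
    moreover have "a - b = ((real (T x) - real (T y)) - M * b) / M"
      using M by (simp add: a_def field_simps)
    ultimately have ab: "\<bar>a - b\<bar> \<le> 1 / M"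
      using M by (simp add: divide_right_mono)
    moreover have "\<bar>b\<bar> \<le> 2 * C"
      using C(2)[OF that(1)] C(2)[OF that(2)] by (simp add: b_def)
    moreover have "1 / M \<le> 1" using M by simp
    ultimately have "\<bar>a + b\<bar> \<le> 4 * C + 1" by linarith
    with ab have "\<bar>a - b\<bar> * \<bar>a + b\<bar> \<le> (1 / M) * (4 * C + 1)"
      using M by (intro mult_mono) auto
    also have "\<dots> \<le> \<mu>" using M by (simp add: field_simps)
    finally have "\<bar>a\<^sup>2 - b\<^sup>2\<bar> \<le> \<mu>"
      by (simp add: power2_eq_square square_diff_square_factored abs_mult mult.commute)
    then show ?thesis by (simp add: a_def b_def power_divide)
  qed
  ultimately show "\<exists>D'. spread_limit V D' \<and>
      (\<forall>x\<in>V. \<forall>y\<in>V. \<bar>D' x y - (t x - t y)\<^sup>2\<bar> \<le> \<mu>)"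
    by (intro exI[of _ "\<lambda>x y. (1 / M\<^sup>2) * (real (T x) - real (T y))\<^sup>2"]) blast
qed

lemma spread_limit_dist:
  fixes q :: "'a \<Rightarrow> 'b::euclidean_space"
  assumes "finite V"
  shows "spread_limit V (\<lambda>x y. (dist (q x) (q y))\<^sup>2)"
proof -
  have "spread_limit V (\<lambda>x y. \<Sum>b\<in>Basis. (q x \<bullet> b - q y \<bullet> b)\<^sup>2)"
    using assms by (intro spread_limit_sum spread_limit_line) auto
  moreover have "(dist (q x) (q y))\<^sup>2 = (\<Sum>b\<in>Basis. (q x \<bullet> b - q y \<bullet> b)\<^sup>2)" for x y
    by (subst euclidean_dist_l2)
       (simp add: L2_set_def dist_real_def sum_nonneg)
  ultimately show ?thesis by simp
qed

text \<open>
  Near the metric \<open>D0\<close> of the regular simplex, the cone contains everything. Merging two points \<open>z\<close> and \<open>w\<close>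
  in the partition into singletons gives the element \<open>P (z, w)\<close>, which is \<open>D0\<close> with the entry at
  \<open>{z, w}\<close> set to zero. With these, single entries of a multiple of \<open>D0\<close> can be decreased by any small
  amounts, which corrects the error of an approximation \<open>R'\<close> of \<open>R\<close>.
\<close>

lemma spread_metric_interior:
  assumes "finite V" and "spread_limit V R" and "\<kappa> > 0"
    and sym: "\<And>x y. x \<in> V \<Longrightarrow> y \<in> V \<Longrightarrow> R x y = R y x"
    and self: "\<And>x. x \<in> V \<Longrightarrow> R x x = 0"
  shows "spread_metric V (\<lambda>x y. R x y + (if x = y then 0 else \<kappa>))"
proof -
  define n where "n = real (card V)"
  define \<mu> where "\<mu> = \<kappa> / (n\<^sup>2 + 1)"
  have \<mu>: "\<mu> > 0" "n\<^sup>2 * \<mu> \<le> \<kappa>"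
    using \<open>\<kappa> > 0\<close> by (auto simp: \<mu>_def field_simps add_pos_nonneg)
  then obtain R' where R': "spread_metric V R'"
      and close: "\<And>x y. x \<in> V \<Longrightarrow> y \<in> V \<Longrightarrow> \<bar>R' x y - R x y\<bar> \<le> \<mu>"
    using assms(2) unfolding spread_limit_def by meson
  obtain idx :: "'a \<Rightarrow> nat" where idx: "inj_on idx V"
    using finite_imp_inj_to_nat_seg[OF assms(1)] by blast
  \<comment> \<open>Starting from \<open>(\<kappa> + \<mu>) * D0\<close>, the entry at \<open>{z, w}\<close> must decrease by \<open>R' z w - R z w + \<mu>\<close>, which is
    nonnegative; half of it is assigned to each of \<open>(z, w)\<close> and \<open>(w, z)\<close>.\<close>
  define c where "c p = (case p of (z, w) \<Rightarrow> if z = w then 0 else (R' z w - R z w + \<mu>) / 2)"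
    for p
  define P where "P p x y = (if x = y \<or> {x, y} = {fst p, snd p} then 0 else 1 :: real)"
    for p and x y :: 'a
  define D0 where "D0 x y = (if x = y then 0 else 1 :: real)" for x y :: 'a
  define rest where "rest = \<kappa> + \<mu> - (\<Sum>p\<in>V \<times> V. c p)"
  have c: "0 \<le> c p \<and> c p \<le> \<mu>" if "p \<in> V \<times> V" for p
    using that close[of "fst p" "snd p"] \<mu> by (auto simp: c_def split: prod.splits)
  have "(\<Sum>p\<in>V \<times> V. c p) \<le> real (card (V \<times> V)) * \<mu>"
    using c by (intro sum_bounded_above) auto
  then have "rest \<ge> 0"
    using \<mu> by (simp add: rest_def n_def card_cartesian_product power2_eq_square)
  have "spread_metric V (P p)" if p: "p \<in> V \<times> V" for p
  proof -
    define g where "g x = (if x = fst p then idx (snd p) else idx x)" for x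
    have "(if g x = g y then 0 else 1) = P p x y" if "x \<in> V" "y \<in> V" for x y
      using that p idx by (auto simp: g_def P_def inj_on_eq_iff doubleton_eq_iff)
    with spread_metric_partition[OF assms(1), of g] show ?thesis
      by (rule spread_metric_cong)
  qed
  then have "spread_metric V (\<lambda>x y. \<Sum>p\<in>V \<times> V. c p * P p x y)"
    using assms(1) c by (intro spread_metric_sum spread_metric_scale) auto
  moreover have "spread_metric V D0"
    by (rule spread_metric_cong[OF spread_metric_partition[OF assms(1), of idx]])
       (use idx in \<open>auto simp: D0_def inj_on_eq_iff\<close>)
  then have "spread_metric V (\<lambda>x y. rest * D0 x y)"
    using \<open>rest \<ge> 0\<close> by (rule spread_metric_scale)
  ultimately have "spread_metric V
      (\<lambda>x y. R' x y + ((\<Sum>p\<in>V \<times> V. c p * P p x y) + rest * D0 x y))"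
    by (intro spread_metric_add R')
  moreover have "R' x y + ((\<Sum>p\<in>V \<times> V. c p * P p x y) + rest * D0 x y)
      = R x y + (if x = y then 0 else \<kappa>)" if xy: "x \<in> V" "y \<in> V" for x y
  proof (cases "x = y")
    case True
    then show ?thesis
      using xy R' by (simp add: P_def D0_def self spread_metric_self)
  next
    case False
    have "(\<Sum>p\<in>V \<times> V. c p * P p x y)
        = (\<Sum>p\<in>V \<times> V. c p - (if p \<in> {(x, y), (y, x)} then c p else 0))"
      using False by (intro sum.cong) (auto simp: P_def doubleton_eq_iff)
    also have "\<dots> = (\<Sum>p\<in>V \<times> V. c p) - (\<Sum>p\<in>{(x, y), (y, x)}. c p)"
      using xy assms(1)
      by (simp add: sum_subtractf Int_absorb1 del: insert_iff flip: sum.inter_restrict)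
    also have "(\<Sum>p\<in>{(x, y), (y, x)}. c p) = c (x, y) + c (y, x)"
      using False by simp
    also have "\<dots> = R' x y - R x y + \<mu>"
      using False sym[OF xy] spread_metric_commute[OF R' xy] by (simp add: c_def)
    finally show ?thesis using False by (simp add: D0_def rest_def)
  qed
  ultimately show ?thesis by (rule spread_metric_cong)
qed

section \<open>Simplices are Ramsey\<close>

text \<open>
  Affine independence of the family \<open>p\<close>, stated through its barycentric coordinate functions. This
  form, unlike one that speaks of the set \<open>p ` V\<close>, is easy to maintain while single points move.
\<close>

definition affinely_separated :: "('a \<Rightarrow> 'b::real_inner) \<Rightarrow> 'a set \<Rightarrow> bool" where
  "affinely_separated p V \<longleftrightarrow>
     (\<forall>z\<in>V. \<exists>w b. \<forall>x\<in>V. w \<bullet> p x + b = (if x = z then 1 else 0))"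

lemma affine_independent_imp_separated:
  fixes \<Delta> :: "'b::euclidean_space set"
  assumes "\<not> affine_dependent \<Delta>"
  shows "affinely_separated (\<lambda>x. x) \<Delta>"
  unfolding affinely_separated_def
proof
  fix z
  assume z: "z \<in> \<Delta>"
  then have "independent ((\<lambda>x. - z + x) ` (\<Delta> - {z}))"
    using assms affine_dependent_iff_dependent2 by blast
  then obtain g :: "'b \<Rightarrow> real"
    where g: "linear g" "\<forall>x\<in>(\<lambda>x. - z + x) ` (\<Delta> - {z}). g x = - 1"
    using linear_independent_extend[of _ "\<lambda>_. - 1"] by blast
  define w where "w = adjoint g 1"
  have w: "w \<bullet> x = g x" for x
    using adjoint_works[OF g(1), of x 1] by (simp add: w_def inner_commute)
  have "w \<bullet> x + (1 - w \<bullet> z) = (if x = z then 1 else 0)" if "x \<in> \<Delta>" for x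
  proof (cases "x = z")
    case False
    then have "w \<bullet> (- z + x) = - 1" using g(2) that by (simp add: w)
    with False show ?thesis by (simp add: inner_diff_right)
  qed simp
  then show "\<exists>w b. \<forall>x\<in>\<Delta>. w \<bullet> x + b = (if x = z then 1 else 0)" by blast
qed

text \<open>
  All other vertices lie on the hyperplane where the barycentric coordinate \<open>w \<bullet> _ + b\<close> of \<open>z\<close> vanishes.
  Move \<open>z\<close> towards this hyperplane along its normal \<open>w\<close>. By Pythagoras, the squared distances from \<open>z\<close> to
  all other vertices drop by the same amount \<open>e\<close>.
\<close>

lemma lower_vertex:
  fixes p :: "'a \<Rightarrow> 'b::real_inner"
  assumes "affinely_separated p V" and z: "z \<in> V"
  obtains q :: "'a \<Rightarrow> 'b" and e where "affinely_separated q V" and "e > 0"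
    and "\<And>x y. x \<in> V \<Longrightarrow> y \<in> V \<Longrightarrow>
      (dist (p x) (p y))\<^sup>2 = (dist (q x) (q y))\<^sup>2 + (if (x = z) = (y = z) then 0 else e)"
proof -
  from assms obtain w b
    where wb: "\<And>x. x \<in> V \<Longrightarrow> w \<bullet> p x + b = (if x = z then 1 else 0)"
    unfolding affinely_separated_def by blast
  define N where "N = w \<bullet> w"
  \<comment> \<open>The step \<open>c\<close> is less than \<open>1 / N\<close>, at which \<open>z\<close> would reach the hyperplane and affine
    independence would be lost.\<close>
  define c where "c = 1 / (1 + N)"
  have "N \<ge> 0" by (simp add: N_def)
  then have c: "c > 0" "c * N < 1" by (auto simp: c_def field_simps)
  define q where "q = p(z := p z - c *\<^sub>R w)"
  define e where "e = c * (2 - c * N)"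
  have "e > 0" using c by (simp add: e_def)
  define k where "k = 1 - c * N"
  have "k > 0" using c by (simp add: k_def)
  have height: "w \<bullet> q x + b = (if x = z then k else 0)" if "x \<in> V" for x
    using wb[OF that] by (auto simp: q_def inner_diff_right k_def N_def)
  have "\<exists>w b. \<forall>x\<in>V. w \<bullet> q x + b = (if x = v then 1 else 0)" if v: "v \<in> V" for v
  proof (cases "v = z")
    case True
    have "(w /\<^sub>R k) \<bullet> q x + b / k = (if x = v then 1 else 0)" if "x \<in> V" for x
    proof -
      have "(w /\<^sub>R k) \<bullet> q x + b / k = (w \<bullet> q x + b) / k"
        by (simp add: add_divide_distrib inverse_eq_divide)
      then show ?thesis using height[OF that] True \<open>k > 0\<close> by simp
    qed
    then show ?thesis by blast
  next
    case False
    from assms v obtain w' b'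
      where w': "\<And>x. x \<in> V \<Longrightarrow> w' \<bullet> p x + b' = (if x = v then 1 else 0)"
      unfolding affinely_separated_def by blast
    \<comment> \<open>The coordinate of \<open>v\<close> has changed only at \<open>z\<close>, by \<open>- c * (w' \<bullet> w)\<close>; a multiple of the
      coordinate of \<open>z\<close> restores it.\<close>
    define s where "s = c * (w' \<bullet> w) / k"
    have "(w' + s *\<^sub>R w) \<bullet> q x + (b' + s * b) = (if x = v then 1 else 0)" if "x \<in> V" for x
    proof -
      have "(w' + s *\<^sub>R w) \<bullet> q x + (b' + s * b) = (w' \<bullet> q x + b') + s * (w \<bullet> q x + b)"
        by (simp add: inner_add_left algebra_simps)
      moreover have "w' \<bullet> q x + b' = (if x = v then 1 else 0) - (if x = z then c * (w' \<bullet> w) else 0)"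
        using w'[OF that] by (auto simp: q_def inner_diff_right)
      ultimately show ?thesis
        using height[OF that] \<open>k > 0\<close> by (simp add: s_def)
    qed
    then show ?thesis by blast
  qed
  then have q_sep: "affinely_separated q V" by (simp add: affinely_separated_def)
  have lowered: "(dist (p z) (p y))\<^sup>2 = (dist (q z) (q y))\<^sup>2 + e" if "y \<in> V" "y \<noteq> z" for y
  proof -
    have "w \<bullet> (p z - p y) = 1"
      using wb[OF z] wb[OF that(1)] that(2) by (simp add: inner_diff_right)
    moreover have "(dist (q z) (q y))\<^sup>2 = (p z - p y - c *\<^sub>R w) \<bullet> (p z - p y - c *\<^sub>R w)"
      using that(2) by (simp add: q_def dist_norm power2_norm_eq_inner algebra_simps)
    then have "(dist (q z) (q y))\<^sup>2
        = (dist (p z) (p y))\<^sup>2 - 2 * c * (w \<bullet> (p z - p y)) + c * (c * N)"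
      by (simp add: dist_norm power2_norm_eq_inner inner_diff_left inner_diff_right
          inner_commute N_def algebra_simps)
    ultimately show ?thesis by (simp add: e_def algebra_simps)
  qed
  have "(dist (p x) (p y))\<^sup>2 = (dist (q x) (q y))\<^sup>2 + (if (x = z) = (y = z) then 0 else e)"
    if "x \<in> V" "y \<in> V" for x y
  proof (cases "x = z")
    case True
    then show ?thesis using lowered[OF that(2)] by auto
  next
    case False
    show ?thesis
    proof (cases "y = z")
      case True
      then show ?thesis using False lowered[OF that(1)] by (simp add: dist_commute)
    next
      case False
      then show ?thesis using \<open>x \<noteq> z\<close> by (simp add: q_def)
    qed
  qed
  from that[OF q_sep \<open>e > 0\<close> this] show ?thesis .
qed

lemma lower_vertices:
  fixes p :: "'a \<Rightarrow> 'b::real_inner"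
  assumes "finite S" and "S \<subseteq> V" and "affinely_separated p V"
  shows "\<exists>(q :: 'a \<Rightarrow> 'b) e. affinely_separated q V \<and> (\<forall>z\<in>S. e z > 0) \<and>
    (\<forall>x\<in>V. \<forall>y\<in>V. (dist (p x) (p y))\<^sup>2
       = (dist (q x) (q y))\<^sup>2 + (\<Sum>z\<in>S. if (x = z) = (y = z) then 0 else e z))"
  using assms(1,2)
proof (induction S)
  case empty
  show ?case by (intro exI[of _ p] exI[of _ "\<lambda>_. 1"]) (simp add: assms(3))
next
  case (insert z S)
  then obtain q :: "'a \<Rightarrow> 'b" and e where q: "affinely_separated q V" "\<forall>z\<in>S. e z > 0"
      "\<forall>x\<in>V. \<forall>y\<in>V. (dist (p x) (p y))\<^sup>2
         = (dist (q x) (q y))\<^sup>2 + (\<Sum>z\<in>S. if (x = z) = (y = z) then 0 else e z)"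
    by auto
  from insert.prems have "z \<in> V" by auto
  from lower_vertex[OF q(1) this] obtain q' :: "'a \<Rightarrow> 'b" and d
    where q': "affinely_separated q' V" "d > 0"
      "\<And>x y. x \<in> V \<Longrightarrow> y \<in> V \<Longrightarrow>
        (dist (q x) (q y))\<^sup>2 = (dist (q' x) (q' y))\<^sup>2 + (if (x = z) = (y = z) then 0 else d)"
    by blast
  have "(\<Sum>v\<in>S. if (x = v) = (y = v) then 0 else (e(z := d)) v)
      = (\<Sum>v\<in>S. if (x = v) = (y = v) then 0 else e v)" for x y
    using insert.hyps by (intro sum.cong) auto
  with q q' insert.hyps show ?case
    by (intro exI[of _ q'] exI[of _ "e(z := d)"]) simp
qed

lemma sum_cut_metrics:
  assumes "finite V" and "x \<in> V" and "y \<in> V"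
  shows "(\<Sum>z\<in>V. if (x = z) = (y = z) then 0 else e z) = (if x = y then 0 else e x + e y :: real)"
proof (cases "x = y")
  case False
  then have "(\<Sum>z\<in>V. if (x = z) = (y = z) then 0 else e z)
      = (\<Sum>z\<in>V. (if z = x then e z else 0) + (if z = y then e z else 0))"
    by (intro sum.cong) auto
  also have "\<dots> = e x + e y"
    using assms by (simp add: sum.distrib)
  finally show ?thesis using False by simp
qed simp

text \<open>
  Lowering every vertex once writes the squared distance as a squared Euclidean distance plus
  positive multiples of the cut metrics of all single vertices. A uniform amount \<open>\<eta>\<close> of each cut
  metric is split off; these amounts add up to \<open>2 * \<eta>\<close> for every pair of distinct vertices. The
  remainder \<open>R\<close> is still a limit of spread metrics, and \<open>spread_metric_interior\<close> applies.
\<close>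

lemma simplex_spread_metric:
  fixes \<Delta> :: "'b::euclidean_space set"
  assumes fin: "finite \<Delta>" and indep: "\<not> affine_dependent \<Delta>"
  shows "spread_metric \<Delta> (\<lambda>x y. (dist x y)\<^sup>2)"
proof (cases "\<Delta> = {}")
  case True
  then show ?thesis by (simp add: spread_metric_def)
next
  case False
  from lower_vertices[OF fin order_refl affine_independent_imp_separated[OF indep]]
  obtain q :: "'b \<Rightarrow> 'b" and e where e: "\<And>z. z \<in> \<Delta> \<Longrightarrow> e z > 0"
    and q: "\<And>x y. x \<in> \<Delta> \<Longrightarrow> y \<in> \<Delta> \<Longrightarrow> (dist x y)\<^sup>2
         = (dist (q x) (q y))\<^sup>2 + (\<Sum>z\<in>\<Delta>. if (x = z) = (y = z) then 0 else e z)"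
    by blast
  define \<eta> where "\<eta> = Min (e ` \<Delta>)"
  have \<eta>: "\<eta> > 0" "\<And>z. z \<in> \<Delta> \<Longrightarrow> \<eta> \<le> e z"
    using e fin False by (auto simp: \<eta>_def)
  define R where "R x y = (dist (q x) (q y))\<^sup>2
      + (\<Sum>z\<in>\<Delta>. (e z - \<eta>) * (if (x = z) = (y = z) then 0 else 1))" for x y
  have "spread_metric \<Delta> (\<lambda>x y. if (x = z) = (y = z) then 0 else 1)" for z
    using spread_metric_partition[OF fin, of "\<lambda>x. if x = z then 1 else 0"]
    by (rule spread_metric_cong) auto
  then have "spread_limit \<Delta> R"
    unfolding R_def using \<eta> fin
    by (intro spread_limit_add spread_limit_dist spread_limit_sum spread_limit_scale
        spread_metric_imp_limit) auto
  then have "spread_metric \<Delta> (\<lambda>x y. R x y + (if x = y then 0 else 2 * \<eta>))"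
    by (rule spread_metric_interior[OF fin])
       (use \<eta>(1) in \<open>auto simp: R_def dist_commute intro!: sum.cong\<close>)
  moreover have "R x y + (if x = y then 0 else 2 * \<eta>) = (dist x y)\<^sup>2"
    if "x \<in> \<Delta>" "y \<in> \<Delta>" for x y
  proof -
    have "(\<Sum>z\<in>\<Delta>. (e z - \<eta>) * (if (x = z) = (y = z) then 0 else 1))
        = (\<Sum>z\<in>\<Delta>. if (x = z) = (y = z) then 0 else e z - \<eta>)"
      by (intro sum.cong) auto
    then show ?thesis
      using q[OF that] sum_cut_metrics[OF fin that, of e]
        sum_cut_metrics[OF fin that, of "\<lambda>z. e z - \<eta>"]
      by (simp add: R_def)
  qed
  ultimately show ?thesis by (rule spread_metric_cong)
qed

text \<open>
  The theorem of Frankl and Roedl, in the form that all dimensions from some point on work.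
\<close>

theorem simplex_Ramsey:
  fixes \<Delta> :: "'b::euclidean_space set" and r :: nat
  assumes "finite \<Delta>" and "\<not> affine_dependent \<Delta>"
  obtains N where "\<And>M col. N \<le> M \<Longrightarrow> col \<in> Eucl M \<rightarrow> {1..r} \<Longrightarrow>
    \<exists>f\<in>\<Delta> \<rightarrow> Eucl M. (\<forall>x\<in>\<Delta>. \<forall>y\<in>\<Delta>. Eucl_dist M (f x) (f y) = dist x y) \<and>
      col constant_on (f ` \<Delta>)"
  using spread_metric_Ramsey[OF simplex_spread_metric[OF assms], of r] by auto

section \<open>Copies inside one factor of the product\<close>

lemma factor_copy:
  assumes j: "j \<in> {0..m}" and f: "f \<in> \<Delta> \<rightarrow> Eucl (n j)"
    and dist: "\<And>x y. x \<in> \<Delta> \<Longrightarrow> y \<in> \<Delta> \<Longrightarrow> Eucl_dist (n j) (f x) (f y) = dist x y"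
  defines "\<iota> \<equiv> \<lambda>z. \<lambda>i\<in>{0..m}. if i = j then z else (\<lambda>_. 0)"
  shows "congruent_copy_in m n \<Delta> (\<iota> ` f ` \<Delta>)"
  unfolding congruent_copy_in_def
proof (intro bexI conjI ballI)
  fix x y
  assume xy: "x \<in> \<Delta>" "y \<in> \<Delta>"
  have "(\<Sum>i\<in>{0..m}. (Eucl_dist (n i) (\<iota> (f x) i) (\<iota> (f y) i))\<^sup>2)
      = (\<Sum>i\<in>{0..m}. if i = j then (dist x y)\<^sup>2 else 0)"
    using dist[OF xy] by (intro sum.cong) (auto simp: \<iota>_def Eucl_dist_def L2_set_def)
  then show "Prod_dist m n ((\<iota> \<circ> f) x) ((\<iota> \<circ> f) y) = dist x y"
    using j by (simp add: Prod_dist_def L2_set_def)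
next
  show "\<iota> \<circ> f \<in> \<Delta> \<rightarrow> Prod_space m n"
    using f by (fastforce simp: \<iota>_def Prod_space_def topspace_Euclidean_space)
qed (simp add: image_image)

theorem theorem1p5:
  fixes \<Delta> :: "(real ^ 'd::finite) set"
    and n0 m r :: nat
    and X :: "(nat \<Rightarrow> real) set"
    and v :: "nat \<Rightarrow> nat \<Rightarrow> real"
    and \<epsilon> :: real
  assumes "n0 \<ge> 1" and "m \<ge> 1" and "r \<ge> 1"
    and "simplex_vertices \<Delta>"
    and "X \<subseteq> Eucl n0" and "bij_betw v {1..m} X"
    and "\<epsilon> > 0"
  shows "\<exists>n :: nat \<Rightarrow> nat. n 0 = n0 \<and> (\<forall>i\<in>{1..m}. n i \<ge> 1) \<and>
    (\<forall>col \<in> Prod_space m n \<rightarrow> {1..r}.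
       \<not> (\<exists>T. congruent_copy_in m n \<Delta> T \<and> monochromatic col T) \<longrightarrow>
       (\<exists>x \<in> (\<Pi>\<^sub>E i\<in>{1..m}. Eucl (n i)).
          \<forall>i\<in>{1..m}. \<not> monochromatic col (eps_sphere n i (x(0 := v i)) \<epsilon>)))"
proof -
  from assms(4) obtain N where N: "\<And>M col. N \<le> M \<Longrightarrow> col \<in> Eucl M \<rightarrow> {1..r} \<Longrightarrow>
    \<exists>f\<in>\<Delta> \<rightarrow> Eucl M. (\<forall>x\<in>\<Delta>. \<forall>y\<in>\<Delta>. Eucl_dist M (f x) (f y) = dist x y) \<and>
      col constant_on (f ` \<Delta>)"
    unfolding simplex_vertices_def using simplex_Ramsey[of \<Delta> r] by blast
  define n where "n i = (if i = 0 then n0 else Suc N)" for i :: nat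
  have "\<exists>T. congruent_copy_in m n \<Delta> T \<and> monochromatic col T"
    if col: "col \<in> Prod_space m n \<rightarrow> {1..r}" for col
  proof -
    define \<iota> where "\<iota> z = (\<lambda>i\<in>{0..m}. if i = 1 then z else (\<lambda>_. 0))" for z :: "nat \<Rightarrow> real"
    have "\<iota> z \<in> Prod_space m n" if "z \<in> Eucl (n 1)" for z
      using that by (auto simp: \<iota>_def Prod_space_def topspace_Euclidean_space)
    then have "col \<circ> \<iota> \<in> Eucl (n 1) \<rightarrow> {1..r}"
      using col by auto
    with N[of "n 1" "col \<circ> \<iota>"] obtain f where f: "f \<in> \<Delta> \<rightarrow> Eucl (n 1)"
        "\<And>x y. x \<in> \<Delta> \<Longrightarrow> y \<in> \<Delta> \<Longrightarrow> Eucl_dist (n 1) (f x) (f y) = dist x y"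
        "(col \<circ> \<iota>) constant_on (f ` \<Delta>)"
      by (auto simp: n_def)
    from factor_copy[of 1 m f \<Delta> n, OF _ f(1,2)] assms(2)
    have "congruent_copy_in m n \<Delta> (\<iota> ` f ` \<Delta>)"
      by (simp add: \<iota>_def)
    moreover have "monochromatic col (\<iota> ` f ` \<Delta>)"
      using f(3) by (auto simp: monochromatic_def constant_on_def)
    ultimately show ?thesis by blast
  qed
  then show ?thesis
    by (intro exI[of _ n]) (auto simp: n_def)
qed

end
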